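(* Suppose $P_{n,K}$ is full-dimensional, and let $a\in\{1,2\}$. The inequality $$x_{1,2}+x_{a,3}-\sum_{i=4}^n x_i\le 3-K$$ (which corresponds to $x_{a,3}+x_3\le 1$ after substituting $x_3=K-2+x_{1,2}-\sum_{i=4}^n x_i$) is facet-defining for $P_{n,K}$.
   Context: $V=\{1,\dots,n\}$ and $E$ is the set of all unordered pairs $ij$ of distinct elements of $V$; $x_{i,j}=x_{j,i}$. A $K$-partition $\pi$ is a collection of $K$ non-empty pairwise disjoint subsets (clusters) of $V$ whose union is $V$. The representative of a cluster is its smallest element. The characteristic vector $x^\pi\in\{0,1\}^{|E|+|V|-3}$ of $\pi$ has components $x_4,\dots,x_n$ and $x_{i,j}$ for $ij\in E$, where $x^\pi_{i,j}=1$ if $i,j$ are in the same cluster and $0$ otherwise, and $x^\pi_u=1$ if $u$ is the representative of its cluster and $0$ otherwise. (Representative variables of vertices $1,2,3$ are not coordinates; they are eliminated via $x_1=1$, $x_2=1-x_{1,2}$, $x_3=K-2+x_{1,2}-\sum_{i=4}^n x_i$.) $P_{n,K}\subset\mathbb R^{|E|+|V|-3}$ is the convex hull of the characteristic vectors $x^\pi$ of all $K$-partitions $\pi$ of $V$ (equivalently, of all $0/1$ solutions of the integer formulation of the $K$-partitioning problem). It is full-dimensional (dimension $|E|+|V|-3$) if and only if $K\in\{3,\dots,n-2\}$. An inequality is facet-defining for $P_{n,K}$ if it is valid for $P_{n,K}$ and the set of points of $P_{n,K}$ satisfying it with equality has dimension $\dim(P_{n,K})-1$. *)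

theory Defs
  imports "HOL-Analysis.Analysis" "HOL-Library.Disjoint_Sets"
begin

(* Labels of the coordinates: Rep u stands for the representative variable x_u, and
   Edge e for the edge variable of the unordered pair e.  As e is a set,
   Edge {i, j} = Edge {j, i}. *)
datatype coord = Rep nat | Edge "nat set"

definition edges :: "nat \<Rightarrow> nat set set" where
  "edges n = {{i, j} | i j. i \<in> {1..n} \<and> j \<in> {1..n} \<and> i \<noteq> j}"

(* The representative variables of the vertices 1, 2, 3 are not coordinates. *)
definition coords :: "nat \<Rightarrow> coord set" where
  "coords n = Rep ` {4..n} \<union> Edge ` edges n"

lemma edges_eq: "edges n = {e. e \<subseteq> {1..n} \<and> card e = 2}"
  unfolding edges_def by (auto simp: card_2_iff) blast+

lemma card_edges: "card (edges n) = n choose 2"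
  unfolding edges_eq using n_subsets[of "{1..n}" 2] by simp

lemma card_coords:
  assumes "n \<ge> 3"
  shows "card (coords n) = (n choose 2) + n - 3"
proof -
  have "finite (edges n)"
    unfolding edges_eq by (rule finite_subset[of _ "Pow {1..n}"]) auto
  then have "card (coords n) = card (Rep ` {4..n}) + card (Edge ` edges n)"
    unfolding coords_def by (intro card_Un_disjoint) auto
  also have "\<dots> = (n - 3) + (n choose 2)"
    by (simp add: card_image inj_on_def card_edges)
  finally show ?thesis using assms by simp
qed

definition K_partition :: "nat \<Rightarrow> nat \<Rightarrow> nat set set \<Rightarrow> bool" where
  "K_partition n K \<pi> \<longleftrightarrow> partition_on {1..n} \<pi> \<and> card \<pi> = K"

definition same_cluster :: "nat set set \<Rightarrow> nat set \<Rightarrow> bool" where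
  "same_cluster \<pi> e \<longleftrightarrow> (\<exists>C\<in>\<pi>. e \<subseteq> C)"

definition representative :: "nat set set \<Rightarrow> nat \<Rightarrow> bool" where
  "representative \<pi> u \<longleftrightarrow> (\<exists>C\<in>\<pi>. u = Min C)"

fun char_entry :: "nat set set \<Rightarrow> coord \<Rightarrow> real" where
  "char_entry \<pi> (Rep u) = of_bool (representative \<pi> u)"
| "char_entry \<pi> (Edge e) = of_bool (same_cluster \<pi> e)"

(* The space with one coordinate for each element of coords n is rendered as real ^ 'i,
   where 'i is any finite index type and idx is a bijection from coords n onto 'i;
   the component of x belonging to the label c is x $ idx c.  By card_coords, 'i has
   |E| + |V| - 3 elements if n \<ge> 3. *)
definition char_vec :: "nat \<Rightarrow> (coord \<Rightarrow> 'i::finite) \<Rightarrow> nat set set \<Rightarrow> real ^ 'i" where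
  "char_vec n idx \<pi> = (\<chi> k. char_entry \<pi> (inv_into (coords n) idx k))"

definition partition_polytope :: "nat \<Rightarrow> nat \<Rightarrow> (coord \<Rightarrow> 'i::finite) \<Rightarrow> (real ^ 'i) set" where
  "partition_polytope n K idx = convex hull (char_vec n idx ` {\<pi>. K_partition n K \<pi>})"

definition full_dimensional :: "'e::euclidean_space set \<Rightarrow> bool" where
  "full_dimensional P \<longleftrightarrow> aff_dim P = int DIM('e)"

(* The inequality l x \<le> b, where l is a linear functional, is facet-defining for P. *)
definition facet_defining :: "'e::euclidean_space set \<Rightarrow> ('e \<Rightarrow> real) \<Rightarrow> real \<Rightarrow> bool" where
  "facet_defining P l b \<longleftrightarrow>
     linear l \<and> (\<forall>x\<in>P. l x \<le> b) \<and> aff_dim {x \<in> P. l x = b} = aff_dim P - 1"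

end

theory Submission
  imports Defs
begin

text \<open>
  A partition is encoded by the map \<open>r\<close> sending each vertex to the representative of its cluster, so
  that \<open>x\<^sub>u = [r u = u]\<close> and \<open>x\<^sub>i\<^sub>j = [r i = r j]\<close>. Full-dimensionality forces \<open>3 \<le> K \<le> n - 2\<close>, because
  otherwise the polytope lies in an explicit hyperplane. The face has codimension one because every
  functional that is constant on its vertices is a multiple of the given one: moving two vertices
  \<open>u, v \<ge> 4\<close> independently between the clusters of 1 and 2 shows that the coefficient of \<open>x\<^sub>u\<^sub>v\<close>
  vanishes; moving \<open>u\<close> between the clusters of 1, 2 and 3 (also with 1 and 2 joined) kills the
  coefficients of \<open>x\<^sub>1\<^sub>u, x\<^sub>2\<^sub>u, x\<^sub>3\<^sub>u\<close>; exchanging a singleton \<open>u\<close> with a non-singleton \<open>v\<close> shows that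
  all \<open>x\<^sub>u\<close> have the same coefficient; and the four ways of clustering 1, 2, 3 allowed on the face
  determine the three remaining coefficients.
\<close>

section \<open>Partitions as maps to representatives\<close>

text \<open>Idempotence together with \<open>r x \<le> x\<close> makes every value of
  \<open>r\<close> the least element of its own fibre, so on \<open>{1..n}\<close> these maps
  correspond to partitions.\<close>

definition rep_map :: "nat \<Rightarrow> (nat \<Rightarrow> nat) \<Rightarrow> bool" where
  "rep_map n r \<longleftrightarrow> (\<forall>x\<in>{1..n}. 1 \<le> r x \<and> r x \<le> x \<and> r (r x) = r x)"

definition fibres :: "nat \<Rightarrow> (nat \<Rightarrow> nat) \<Rightarrow> nat set set" where
  "fibres n r = (\<lambda>y. {x \<in> {1..n}. r x = y}) ` r ` {1..n}"

lemma rep_mapD: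
  assumes "rep_map n r" "x \<in> {1..n}"
  shows "1 \<le> r x" "r x \<le> x" "r (r x) = r x" "r x \<in> {1..n}"
  using assms unfolding rep_map_def by fastforce+

lemma rep_map_image: "rep_map n r \<Longrightarrow> r ` {1..n} = {u \<in> {1..n}. r u = u}"
  using rep_mapD(3,4) by (force simp del: atLeastAtMost_iff)

lemma partition_on_fibres: "partition_on {1..n} (fibres n r)"
  by (rule partition_onI) (auto simp: fibres_def disjnt_def)

lemma card_fibres: "card (fibres n r) = card (r ` {1..n})"
  unfolding fibres_def
proof (rule card_image, rule inj_onI)
  fix y z assume "y \<in> r ` {1..n}" "{x \<in> {1..n}. r x = y} = {x \<in> {1..n}. r x = z}"
  then show "y = z" by blast
qed

lemma K_partition_fibres: "K_partition n K (fibres n r) \<longleftrightarrow> card (r ` {1..n}) = K"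
  by (simp add: K_partition_def partition_on_fibres card_fibres del: One_nat_def)

lemma same_cluster_fibres:
  "\<lbrakk>i \<in> {1..n}; j \<in> {1..n}\<rbrakk> \<Longrightarrow> same_cluster (fibres n r) {i, j} \<longleftrightarrow> r i = r j"
  by (auto simp: same_cluster_def fibres_def)

text \<open>The fibre over \<open>r y\<close> contains \<open>r y\<close> by idempotence and nothing
  smaller, since \<open>r x \<le> x\<close>; hence representatives are the values of
  \<open>r\<close>, which are its fixed points.\<close>

lemma representative_fibres:
  assumes "rep_map n r" "u \<in> {1..n}"
  shows "representative (fibres n r) u \<longleftrightarrow> r u = u"
proof -
  have Min: "Min {x \<in> {1..n}. r x = r y} = r y" if "y \<in> {1..n}" for y
    using rep_mapD(3,4)[OF assms(1) that] rep_mapD(2)[OF assms(1)] by (intro Min_eqI) fastforce+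
  have "representative (fibres n r) u \<longleftrightarrow> (\<exists>y\<in>{1..n}. u = r y)"
    unfolding representative_def fibres_def using Min by (auto simp del: atLeastAtMost_iff)
  also have "\<dots> \<longleftrightarrow> r u = u"
    using rep_mapD(3)[OF assms(1)] assms(2) by (metis (no_types))
  finally show ?thesis .
qed

lemma partition_eq_fibres:
  assumes "partition_on {1..n} \<pi>"
  obtains r where "rep_map n r" "\<pi> = fibres n r"
proof -
  \<comment> \<open>By disjointness only one cluster contains a given vertex \<open>x\<close>, so
    the union merely names that cluster.\<close>
  define r where "r x = Min (\<Union>{C \<in> \<pi>. x \<in> C})" for x
  have sub: "C \<subseteq> {1..n}" if "C \<in> \<pi>" for C
    using assms that by (auto simp: partition_on_def)
  have fin: "finite C" if "C \<in> \<pi>" for C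
    using sub[OF that] finite_subset by blast
  have ne: "C \<noteq> {}" if "C \<in> \<pi>" for C
    using assms that by (auto simp: partition_on_def)
  have uniq: "C = D" if "C \<in> \<pi>" "D \<in> \<pi>" "x \<in> C" "x \<in> D" for x C D
    using assms that by (auto simp: partition_on_def disjoint_def)
  have r: "r x = Min C" if "C \<in> \<pi>" "x \<in> C" for x C
  proof -
    have "{D \<in> \<pi>. x \<in> D} = {C}" using uniq that by auto
    then show ?thesis by (simp add: r_def)
  qed
  have cov: "\<exists>C\<in>\<pi>. x \<in> C" if "x \<in> {1..n}" for x
    using assms that by (auto simp: partition_on_def)
  have MinC: "Min C \<in> C" if "C \<in> \<pi>" for C
    using fin ne that by simp
  have fib: "{y \<in> {1..n}. r y = Min C} = C" if C: "C \<in> \<pi>" for C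
  proof (intro equalityI subsetI)
    fix y assume "y \<in> {y \<in> {1..n}. r y = Min C}"
    then obtain D where "D \<in> \<pi>" "y \<in> D" "Min D = Min C"
      using cov r by (metis (mono_tags, lifting) mem_Collect_eq)
    then show "y \<in> C" using uniq[OF _ C, of D "Min D"] MinC C by metis
  next
    fix y assume "y \<in> C"
    then show "y \<in> {y \<in> {1..n}. r y = Min C}" using r[OF C] sub[OF C] by blast
  qed
  have "rep_map n r" unfolding rep_map_def
  proof
    fix x assume "x \<in> {1..n}"
    then obtain C where C: "C \<in> \<pi>" "x \<in> C" using cov by blast
    have "Min C \<le> x" using C fin by simp
    moreover have "Min C \<in> {1..n}" using MinC sub C by blast
    ultimately show "1 \<le> r x \<and> r x \<le> x \<and> r (r x) = r x"
      using r[OF C] r[OF C(1) MinC[OF C(1)]] by simp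
  qed
  moreover have "r ` {1..n} = Min ` \<pi>"
  proof (intro equalityI subsetI)
    fix y assume "y \<in> r ` {1..n}"
    then show "y \<in> Min ` \<pi>" using cov r by blast
  next
    fix y assume "y \<in> Min ` \<pi>"
    then obtain C where C: "C \<in> \<pi>" "y = Min C" by blast
    then have "y = r y" "y \<in> {1..n}" using r[OF C(1) MinC[OF C(1)]] MinC[OF C(1)] sub[OF C(1)] by auto
    then show "y \<in> r ` {1..n}" by (rule image_eqI)
  qed
  then have "fibres n r = (\<lambda>C. {y \<in> {1..n}. r y = Min C}) ` \<pi>"
    by (simp add: fibres_def image_image)
  then have "\<pi> = fibres n r" using fib by simp
  ultimately show ?thesis using that by blast
qed

section \<open>Coordinates of characteristic vectors\<close>

lemma Rep_coords: "Rep u \<in> coords n \<longleftrightarrow> u \<in> {4..n}"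
  by (auto simp: coords_def)

lemma Edge_coords: "Edge {i, j} \<in> coords n \<longleftrightarrow> i \<in> {1..n} \<and> j \<in> {1..n} \<and> i \<noteq> j"
  by (auto simp: coords_def edges_def doubleton_eq_iff)

lemma finite_edges: "finite (edges n)"
  unfolding edges_eq by (rule finite_subset[of _ "Pow {1..n}"]) auto

lemma finite_coords: "finite (coords n)"
  by (simp add: coords_def finite_edges)

lemma char_vec_nth:
  "\<lbrakk>bij_betw idx (coords n) UNIV; c \<in> coords n\<rbrakk> \<Longrightarrow> char_vec n idx \<pi> $ idx c = char_entry \<pi> c"
  by (simp add: char_vec_def bij_betw_def inv_into_f_f)

lemma char_vec_Rep:
  assumes "bij_betw idx (coords n) UNIV" "rep_map n r" "u \<in> {4..n}"
  shows "char_vec n idx (fibres n r) $ idx (Rep u) = of_bool (r u = u)"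
  using assms by (simp add: char_vec_nth Rep_coords representative_fibres)

lemma char_vec_Edge:
  assumes "bij_betw idx (coords n) UNIV" "i \<in> {1..n}" "j \<in> {1..n}" "i \<noteq> j"
  shows "char_vec n idx (fibres n r) $ idx (Edge {i, j}) = of_bool (r i = r j)"
  using assms by (simp add: char_vec_nth Edge_coords same_cluster_fibres del: atLeastAtMost_iff)

lemma inner_char_vec:
  assumes "bij_betw idx (coords n) UNIV"
  shows "g \<bullet> char_vec n idx \<pi> = (\<Sum>c\<in>coords n. g $ idx c * char_entry \<pi> c)"
proof -
  have "g \<bullet> char_vec n idx \<pi> = (\<Sum>k\<in>UNIV. g $ k * char_vec n idx \<pi> $ k)"
    by (simp add: inner_vec_def)
  also have "\<dots> = (\<Sum>c\<in>coords n. g $ idx c * char_vec n idx \<pi> $ idx c)"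
    by (rule sum.reindex_bij_betw[OF assms, symmetric])
  also have "\<dots> = (\<Sum>c\<in>coords n. g $ idx c * char_entry \<pi> c)"
    using assms by (simp add: char_vec_nth)
  finally show ?thesis .
qed

lemma sum_upto_split3:
  fixes h :: "nat \<Rightarrow> real"
  assumes "3 \<le> n"
  shows "(\<Sum>i=1..n. h i) = h 1 + h 2 + h 3 + (\<Sum>i=4..n. h i)"
  using assms by (simp add: sum.atLeast_Suc_atMost numeral_2_eq_2 numeral_3_eq_3 eval_nat_numeral)

text \<open>This is the elimination of x_3: all fixed points together number as many as the
  clusters, vertex 1 is always fixed, and vertex 2 is fixed unless it shares the cluster of
  1.\<close>

lemma sum_representatives:
  assumes "rep_map n r" "3 \<le> n"
  shows "(\<Sum>u=4..n. of_bool (r u = u)) =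
    real (card (r ` {1..n})) - 2 + of_bool (r 1 = r 2) - of_bool (r 3 = 3)"
proof -
  have "real (card (r ` {1..n})) = (\<Sum>u=1..n. of_bool (r u = u))"
    by (simp add: rep_map_image[OF assms(1)] Int_def conj_assoc del: One_nat_def)
  also have "\<dots> = of_bool (r 1 = 1) + of_bool (r 2 = 2) + of_bool (r 3 = 3)
      + (\<Sum>u=4..n. of_bool (r u = u))"
    by (rule sum_upto_split3[OF assms(2)])
  moreover have "r 1 = 1" using rep_mapD[OF assms(1), of 1] assms(2) by simp
  moreover have "r 2 = 2 \<or> r 2 = 1" using rep_mapD(1,2)[OF assms(1), of 2] assms(2) by fastforce
  ultimately show ?thesis by auto
qed

section \<open>Affine dimension and constant linear functionals\<close>

text \<open>The functionals constant on \<open>S\<close> form the orthogonal complement of the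
  directions \<open>x - v\<close>. If that complement has dimension at most 1, the directions span
  at least a hyperplane.\<close>

lemma aff_dim_ge_if_annihilator_le_span:
  fixes S :: "'e::euclidean_space set"
  assumes "v \<in> S" and ann: "\<And>g. (\<And>x. x \<in> S \<Longrightarrow> g \<bullet> x = g \<bullet> v) \<Longrightarrow> g \<in> span {h}"
  shows "int DIM('e) - 1 \<le> aff_dim S"
proof -
  define T where "T = (+) (- v) ` S"
  let ?C = "{y. \<forall>x\<in>span T. orthogonal x y}"
  have "dim {y \<in> UNIV. \<forall>x\<in>span T. orthogonal x y} + dim (span T) = dim (UNIV :: 'e set)"
    by (rule dim_subspace_orthogonal_to_vectors) auto
  then have "dim ?C + dim T = DIM('e)" by simp
  moreover have "?C \<subseteq> span {h}"
  proof
    fix g assume "g \<in> ?C"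
    then have "orthogonal x g" if "x \<in> T" for x
      using that span_base by blast
    then have "orthogonal (x - v) g" if "x \<in> S" for x
      using that unfolding T_def by (metis image_eqI add.commute diff_conv_add_uminus)
    then have "g \<bullet> x = g \<bullet> v" if "x \<in> S" for x
      using that by (fastforce simp: orthogonal_def inner_commute[of _ g] inner_diff_right)
    then show "g \<in> span {h}" by (rule ann)
  qed
  then have "dim ?C \<le> card {h}" by (intro dim_le_card) auto
  moreover have "aff_dim S = int (dim T)"
    unfolding T_def by (rule aff_dim_eq_dim) (simp add: assms(1) hull_inc)
  ultimately show ?thesis by simp
qed

lemma aff_dim_le_if_linear_const:
  fixes S :: "'e::euclidean_space set" and l :: "'e \<Rightarrow> real"
  assumes "linear l" "l z \<noteq> 0" "\<And>x. x \<in> S \<Longrightarrow> l x = b"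
  shows "aff_dim S \<le> int DIM('e) - 1"
proof -
  obtain g where g: "l x = g \<bullet> x" for x
  proof
    fix x
    \<comment> \<open>The adjoint at 1 is the vector that represents \<open>l\<close> by the inner
      product.\<close>
    show "l x = adjoint l 1 \<bullet> x"
      using adjoint_works[OF assms(1), of x 1] by (simp add: inner_commute)
  qed
  have "g \<noteq> 0" using assms(2) g by auto
  have "aff_dim S \<le> aff_dim {x. g \<bullet> x = b}"
    by (rule aff_dim_subset) (use assms(3) g in auto)
  also have "\<dots> = int DIM('e) - 1"
    using aff_dim_hyperplane[of g b] \<open>g \<noteq> 0\<close> DIM_positive[where 'a='e] by (simp add: of_nat_diff)
  finally show ?thesis .
qed

lemma convex_hull_linear_const:
  fixes l :: "'e::real_vector \<Rightarrow> real"
  assumes "linear l" "\<And>x. x \<in> V \<Longrightarrow> l x = b" "x \<in> convex hull V"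
  shows "l x = b"
proof -
  have "convex {x. l x = b}"
    using convex_linear_vimage[OF assms(1), of "{b}"] by (simp add: vimage_def)
  then have "convex hull V \<subseteq> {x. l x = b}" using assms(2) by (intro hull_minimal) auto
  then show ?thesis using assms(3) by auto
qed

lemma convex_hull_linear_le:
  fixes l :: "'e::real_vector \<Rightarrow> real"
  assumes "linear l" "\<And>x. x \<in> V \<Longrightarrow> l x \<le> b" "x \<in> convex hull V"
  shows "l x \<le> b"
proof -
  have "convex {x. l x \<le> b}"
    using convex_linear_vimage[OF assms(1), of "{..b}"] by (simp add: vimage_def)
  then have "convex hull V \<subseteq> {x. l x \<le> b}" using assms(2) by (intro hull_minimal) auto
  then show ?thesis using assms(3) by auto
qed

section \<open>Full-dimensionality bounds the number of clusters\<close>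

text \<open>Otherwise all vertices, and hence their hull, would lie in the hyperplane
  \<open>l x = b\<close>; the point \<open>z\<close> certifies that \<open>l\<close> is not
  zero.\<close>

lemma full_dimensional_not_const:
  fixes idx :: "coord \<Rightarrow> 'i::finite" and l :: "real ^ 'i \<Rightarrow> real"
  assumes "full_dimensional (partition_polytope n K idx)" "linear l" "l z \<noteq> 0"
  obtains r where "rep_map n r" "card (r ` {1..n}) = K" "l (char_vec n idx (fibres n r)) \<noteq> b"
proof (rule ccontr)
  assume "\<not> thesis"
  with that have r: "l (char_vec n idx (fibres n r)) = b"
    if "rep_map n r" "card (r ` {1..n}) = K" for r using that by blast
  have "l x = b" if "x \<in> char_vec n idx ` {\<pi>. K_partition n K \<pi>}" for x
  proof -
    from that obtain \<pi> where \<pi>: "K_partition n K \<pi>" "x = char_vec n idx \<pi>" by blast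
    then obtain r' where "rep_map n r'" "\<pi> = fibres n r'"
      unfolding K_partition_def by (blast elim: partition_eq_fibres)
    then show ?thesis using \<pi> r[of r'] by (simp add: K_partition_fibres)
  qed
  then have "l x = b" if "x \<in> partition_polytope n K idx" for x
    using that convex_hull_linear_const[OF assms(2)] unfolding partition_polytope_def by blast
  then have "aff_dim (partition_polytope n K idx) \<le> int DIM(real ^ 'i) - 1"
    by (rule aff_dim_le_if_linear_const[OF assms(2,3)])
  then show False using assms(1) by (simp add: full_dimensional_def)
qed


text \<open>If 3 is not a representative, its representative is 1 or 2, and that vertex is fixed by
  \<open>r\<close>.\<close>

lemma rep_map_3_iff:
  assumes "rep_map n r" "3 \<le> n"
  shows "r 3 = 3 \<longleftrightarrow> r 3 \<noteq> r 1 \<and> r 3 \<noteq> r 2"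
proof -
  have "r 1 \<le> 1" "r 2 \<le> 2" "1 \<le> r 3" "r 3 \<le> 3" "r (r 3) = r 3"
    using rep_mapD[OF assms(1)] assms(2) by auto
  moreover have "r 3 = 1 \<or> r 3 = 2 \<or> r 3 = 3" using calculation by linarith
  ultimately show ?thesis by auto
qed

lemma partition_number_bounds:
  fixes idx :: "coord \<Rightarrow> 'i::finite"
  assumes idx: "bij_betw idx (coords n) UNIV"
    and full: "full_dimensional (partition_polytope n K idx)"
  shows "3 \<le> K" "K + 2 \<le> n"
proof -
  note coord = char_vec_Edge[OF idx] char_vec_Rep[OF idx]
  have lin: "linear (\<lambda>x::real^'i. x $ idx c)" for c
    by (simp add: linear_iff)
  have inj: "idx c = idx d \<longleftrightarrow> c = d" if "c \<in> coords n" "d \<in> coords n" for c d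
    using idx that by (auto simp: bij_betw_def inj_on_def)
  \<comment> \<open>The index type is inhabited, so some coordinate exists, and either kind of
    coordinate needs two vertices.\<close>
  have "coords n \<noteq> {}" using idx by (auto simp: bij_betw_def)
  then have n2: "2 \<le> n"
    by (auto simp: coords_def edges_def)
  have nz12: "axis (idx (Edge {1,2})) (1::real) $ idx (Edge {1,2}) \<noteq> 0" by simp
  \<comment> \<open>The extreme values of \<open>K\<close> make x_12 constant: with fewer than two
    clusters 1 and 2 are never separated, with at least \<open>n\<close> clusters they are never
    joined.\<close>
  have "2 \<le> K"
  proof (rule ccontr)
    assume "\<not> 2 \<le> K"
    obtain r where r: "rep_map n r" "card (r ` {1..n}) = K"
      "char_vec n idx (fibres n r) $ idx (Edge {1,2}) \<noteq> 1"
      by (rule full_dimensional_not_const[OF full lin nz12])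
    then have "r 1 \<noteq> r 2" using n2 coord(1)[of 1 2 r] by auto
    then have "card {r 1, r 2} = 2" by simp
    moreover have "card {r 1, r 2} \<le> card (r ` {1..n})" using n2 by (intro card_mono) auto
    ultimately show False using r \<open>\<not> 2 \<le> K\<close> by simp
  qed
  have "K < n"
  proof (rule ccontr)
    assume "\<not> K < n"
    obtain r where r: "rep_map n r" "card (r ` {1..n}) = K"
      "char_vec n idx (fibres n r) $ idx (Edge {1,2}) \<noteq> 0"
      by (rule full_dimensional_not_const[OF full lin nz12])
    then have "r 1 = r 2" using n2 coord(1)[of 1 2 r] by auto
    then have "\<not> inj_on r {1..n}" using n2 inj_onD[of r "{1..n}" 1 2] by auto
    then have "card (r ` {1..n}) < card {1..n}"
      using card_image_le[of "{1..n}" r] eq_card_imp_inj_on[of "{1..n}" r] by fastforce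
    then show False using r \<open>\<not> K < n\<close> by simp
  qed
  with \<open>2 \<le> K\<close> have n3: "3 \<le> n" by simp
  show K3: "3 \<le> K"
  proof (rule ccontr)
    assume "\<not> 3 \<le> K"
    with \<open>2 \<le> K\<close> have "K = 2" by simp
    \<comment> \<open>The first three terms sum to 3 if 1, 2, 3 share a cluster and to 1 otherwise; in the former
      case there is exactly one representative outside \<open>{1, 2, 3}\<close>, in the latter none.\<close>
    define l where "l x = x $ idx (Edge {1,2}) + x $ idx (Edge {1,3}) + x $ idx (Edge {2,3})
      - 2 * (\<Sum>i=4..n. x $ idx (Rep i))" for x :: "real^'i"
    have "linear l" unfolding l_def
      by (simp add: linear_iff algebra_simps sum.distrib sum_distrib_left)
    moreover have "l (axis (idx (Edge {1,2})) 1) \<noteq> 0"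
      using n3 by (simp add: l_def axis_def inj Edge_coords Rep_coords doubleton_eq_iff)
    ultimately obtain r where r: "rep_map n r" "card (r ` {1..n}) = K"
      "l (char_vec n idx (fibres n r)) \<noteq> 1"
      by (rule full_dimensional_not_const[OF full])
    have "card {r 1, r 2, r 3} \<le> 2"
      using card_mono[of "r ` {1..n}" "{r 1, r 2, r 3}"] n3 r \<open>K = 2\<close> by auto
    then have "r 1 = r 2 \<or> r 1 = r 3 \<or> r 2 = r 3" by (auto simp: card_insert_if split: if_splits)
    moreover have "l (char_vec n idx (fibres n r)) =
      of_bool (r 1 = r 2) + of_bool (r 1 = r 3) + of_bool (r 2 = r 3)
      - 2 * (of_bool (r 1 = r 2) - of_bool (r 3 = 3))"
      using sum_representatives[OF r(1) n3] r n3 \<open>K = 2\<close> by (simp add: l_def coord)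
    moreover have "r 3 = 3 \<longleftrightarrow> r 3 \<noteq> r 1 \<and> r 3 \<noteq> r 2" by (rule rep_map_3_iff[OF r(1) n3])
    ultimately show False using r(3)
      by (cases "r 1 = r 2"; cases "r 1 = r 3"; cases "r 2 = r 3") simp_all
  qed
  show "K + 2 \<le> n"
  proof (rule ccontr)
    assume "\<not> K + 2 \<le> n"
    with \<open>K < n\<close> K3 have Kn: "n = K + 1" "4 \<le> n" by auto
    \<comment> \<open>At most one vertex is not a representative, so clusters have at most two elements and 4 is
      either a representative or joined to exactly one smaller vertex.\<close>
    define l where "l x = x $ idx (Edge {1,4}) + x $ idx (Edge {2,4}) + x $ idx (Edge {3,4}) + x $ idx (Rep 4)"
      for x :: "real^'i"
    have "linear l" unfolding l_def by (simp add: linear_iff algebra_simps)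
    moreover have "l (axis (idx (Rep 4)) 1) \<noteq> 0"
      using Kn by (simp add: l_def axis_def inj Edge_coords Rep_coords doubleton_eq_iff)
    ultimately obtain r where r: "rep_map n r" "card (r ` {1..n}) = K"
      "l (char_vec n idx (fibres n r)) \<noteq> 1"
      by (rule full_dimensional_not_const[OF full])
    have "card {u \<in> {1..n}. r u \<noteq> u} = n - K"
    proof -
      have "{u \<in> {1..n}. r u \<noteq> u} = {1..n} - r ` {1..n}" unfolding rep_map_image[OF r(1)] by auto
      moreover have "r ` {1..n} \<subseteq> {1..n}" unfolding rep_map_image[OF r(1)] by auto
      ultimately show ?thesis using r(2) by (simp add: card_Diff_subset)
    qed
    then obtain z where z: "{u \<in> {1..n}. r u \<noteq> u} = {z}" using Kn by (auto simp: card_1_singleton_iff)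
    have fixd: "r u = u" if "u \<in> {1..n}" "u \<noteq> z" for u using z that by blast
    have z': "z \<in> {1..n}" "r z \<noteq> z" using z by auto
    have "r 4 \<in> {1,2,3,4}" using rep_mapD[OF r(1), of 4] Kn by auto
    have l: "l (char_vec n idx (fibres n r)) =
      of_bool (r 1 = r 4) + of_bool (r 2 = r 4) + of_bool (r 3 = r 4) + of_bool (r 4 = 4)"
      using Kn(2) r(1) by (simp add: l_def coord)
    show False
    proof (cases "z = 4")
      case True
      then have "r 1 = 1" "r 2 = 2" "r 3 = 3" using fixd Kn by auto
      then show False using r(3) z' True \<open>r 4 \<in> {1,2,3,4}\<close> unfolding l by auto
    next
      case False
      then have "r 4 = 4" using fixd Kn by simp
      moreover have "r 1 \<le> 1" "r 2 \<le> 2" "r 3 \<le> 3" using rep_mapD(2)[OF r(1)] Kn by auto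
      ultimately show False using r(3) unfolding l by auto
    qed
  qed
qed

section \<open>Test partitions obtained by gluing\<close>

text \<open>\<open>glue p S q\<close> clusters 1, 2, 3 according to \<open>p\<close>, makes the elements of \<open>S\<close> singletons and attaches
  every other vertex \<open>x\<close> to the cluster represented by \<open>q x \<in> {1, 2, 3}\<close>.\<close>

definition glue :: "(nat \<Rightarrow> nat) \<Rightarrow> nat set \<Rightarrow> (nat \<Rightarrow> nat) \<Rightarrow> nat \<Rightarrow> nat" where
  "glue p S q x = (if x \<le> 3 then p x else if x \<in> S then x else q x)"

text \<open>The condition \<open>p (q x) = q x\<close> lets a vertex be attached only to an actual
  representative, which keeps \<open>glue p S q\<close> idempotent.\<close>

definition glueable :: "nat \<Rightarrow> (nat \<Rightarrow> nat) \<Rightarrow> nat set \<Rightarrow> (nat \<Rightarrow> nat) \<Rightarrow> bool" where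
  "glueable n p S q \<longleftrightarrow> rep_map 3 p \<and> S \<subseteq> {4..n} \<and> (\<forall>x. q x \<in> {1,2,3} \<and> p (q x) = q x)"

lemma atLeastAtMost_1_3: "{1..3::nat} = {1,2,3}"
  by auto

lemma rep_map_glue:
  assumes "glueable n p S q"
  shows "rep_map n (glue p S q)"
  unfolding rep_map_def
proof
  fix x assume x: "x \<in> {1..n}"
  have p: "rep_map 3 p" and q: "q x \<in> {1..3}" "p (q x) = q x"
    using assms unfolding glueable_def atLeastAtMost_1_3 by blast+
  show "1 \<le> glue p S q x \<and> glue p S q x \<le> x \<and> glue p S q (glue p S q x) = glue p S q x"
  proof (cases "x \<le> 3")
    case True
    then show ?thesis using rep_mapD[OF p, of x] x by (simp add: glue_def)
  next
    case False
    then show ?thesis using q by (simp add: glue_def)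
  qed
qed

text \<open>Attached vertices open no new cluster, so the clusters are those met by 1, 2, 3 and one
  for each element of \<open>S\<close>.\<close>

lemma card_glue:
  assumes "glueable n p S q" "3 \<le> n"
  shows "card (glue p S q ` {1..n}) = card (p ` {1..3}) + card S"
proof -
  have S: "S \<subseteq> {4..n}" and p: "rep_map 3 p" and q: "q x \<in> {1..3}" "p (q x) = q x" for x
    using assms(1) unfolding glueable_def atLeastAtMost_1_3 by blast+
  have "glue p S q ` {1..n} = glue p S q ` {1..3} \<union> glue p S q ` {4..n}"
    using assms(2) by (subst image_Un[symmetric], intro arg_cong[where f="image _"]) auto
  also have "glue p S q ` {1..3} = p ` {1..3}" by (intro image_cong) (auto simp: glue_def)
  also have "p ` {1..3} \<union> glue p S q ` {4..n} = p ` {1..3} \<union> S"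
  proof -
    have "glue p S q x \<in> p ` {1..3} \<union> S" if "x \<in> {4..n}" for x
      using that q[of x] by (auto simp: glue_def image_iff intro!: bexI[of _ "q x"])
    moreover have "x \<in> glue p S q ` {4..n}" if "x \<in> S" for x
      using that S by (intro image_eqI[of _ _ x]) (auto simp: glue_def)
    ultimately show ?thesis by blast
  qed
  also have "card \<dots> = card (p ` {1..3}) + card S"
  proof (rule card_Un_disjoint)
    show "finite S" using S finite_subset by blast
    show "p ` {1..3} \<inter> S = {}" using rep_mapD(4)[OF p] S by fastforce
  qed simp
  finally show ?thesis .
qed

lemma sum_coords:
  "(\<Sum>c\<in>coords n. F c) = (\<Sum>e\<in>edges n. F (Edge e)) + (\<Sum>u=4..n. F (Rep u))"
proof -
  have "(\<Sum>c\<in>coords n. F c) = (\<Sum>c\<in>Rep ` {4..n}. F c) + (\<Sum>c\<in>Edge ` edges n. F c)"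
    unfolding coords_def by (rule sum.union_disjoint) (auto simp: finite_edges)
  then show ?thesis by (simp add: sum.reindex inj_on_def add.commute)
qed

text \<open>Every other edge has both ends in \<open>{4..n}\<close>, where \<open>W\<close>
  vanishes.\<close>

lemma sum_edges_split:
  fixes W :: "nat set \<Rightarrow> real"
  assumes "3 \<le> n" and W: "\<And>u v. \<lbrakk>u \<in> {4..n}; v \<in> {4..n}; u \<noteq> v\<rbrakk> \<Longrightarrow> W {u, v} = 0"
  shows "(\<Sum>e\<in>edges n. W e) = W {1,2} + W {1,3} + W {2,3}
    + (\<Sum>u=4..n. W {1,u} + W {2,u} + W {3,u})"
proof -
  let ?A = "{{1,2},{1,3},{2,3::nat}}" and ?f = "\<lambda>(u, i). {i, u::nat}"
  let ?B = "?f ` ({4..n} \<times> {1,2,3})"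
  have "(\<Sum>e\<in>edges n. W e) = (\<Sum>e\<in>?A \<union> ?B. W e)"
  proof (rule sum.mono_neutral_right[OF finite_edges])
    show "?A \<union> ?B \<subseteq> edges n" using assms(1) by (auto simp: edges_eq)
    show "\<forall>e\<in>edges n - (?A \<union> ?B). W e = 0"
    proof
      fix e assume e: "e \<in> edges n - (?A \<union> ?B)"
      then obtain i j where ij: "e = {i, j}" "i \<in> {1..n}" "j \<in> {1..n}" "i \<noteq> j"
        by (auto simp: edges_def)
      have small: "k \<in> {1,2,3} \<or> k \<in> {4..n}" if "k \<in> {1..n}" for k using that by auto
      have "e \<in> ?B" if "i \<in> {1,2,3} \<and> j \<in> {4..n}"
        using that ij(1) by (intro image_eqI[of _ _ "(j, i)"]) auto
      moreover have "e \<in> ?B" if "j \<in> {1,2,3} \<and> i \<in> {4..n}"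
        using that ij(1) by (intro image_eqI[of _ _ "(i, j)"]) auto
      moreover have "e \<in> ?A" if "i \<in> {1,2,3} \<and> j \<in> {1,2,3}"
        using that ij(1,4) by (elim conjE insertE emptyE) (simp_all add: doubleton_eq_iff)
      moreover have "e \<notin> ?A" "e \<notin> ?B" using e by blast+
      ultimately have "i \<in> {4..n}" "j \<in> {4..n}" using small[OF ij(2)] small[OF ij(3)] by metis+
      then show "W e = 0" using W ij by simp
    qed
  qed
  also have "\<dots> = (\<Sum>e\<in>?A. W e) + (\<Sum>e\<in>?B. W e)"
  proof (rule sum.union_disjoint)
    have "\<forall>e\<in>?A. \<forall>x\<in>e. x \<le> 3" by simp
    moreover have "\<exists>x\<in>e. \<not> x \<le> 3" if "e \<in> ?B" for e
    proof -
      from that obtain u i where "e = {i, u}" "u \<in> {4..n}" by (elim imageE SigmaE) simp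
      then show ?thesis by (intro bexI[of _ u]) simp_all
    qed
    ultimately show "?A \<inter> ?B = {}" by (meson disjoint_iff)
  qed simp_all
  also have "(\<Sum>e\<in>?A. W e) = W {1,2} + W {1,3} + W {2,3}"
    by (simp add: doubleton_eq_iff)
  also have "(\<Sum>e\<in>?B. W e) = (\<Sum>z\<in>{4..n} \<times> {1,2,3}. W (?f z))"
  proof (subst sum.reindex)
    show "inj_on ?f ({4..n} \<times> {1,2,3})"
      by (rule inj_onI) (clarsimp simp: doubleton_eq_iff, auto)
  qed simp
  also have "\<dots> = (\<Sum>u=4..n. W {1,u} + W {2,u} + W {3,u})"
    using sum.cartesian_product[of "\<lambda>u i. W {i, u}" "{1,2,3}" "{4..n}"]
    by (simp add: add.assoc split_def)
  finally show ?thesis .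
qed


text \<open>Once the coefficients between vertices above 3 are zero, each such vertex contributes a
  summand of its own, depending only on where that vertex is placed. Moving one vertex then changes
  one summand.\<close>

lemma sum_glue:
  fixes w :: "coord \<Rightarrow> real"
  assumes G: "glueable n p S q" and "3 \<le> n"
    and w: "\<And>u v. \<lbrakk>u \<in> {4..n}; v \<in> {4..n}; u \<noteq> v\<rbrakk> \<Longrightarrow> w (Edge {u, v}) = 0"
  shows "(\<Sum>c\<in>coords n. w c * char_entry (fibres n (glue p S q)) c) =
    w (Edge {1,2}) * of_bool (p 1 = p 2) + w (Edge {1,3}) * of_bool (p 1 = p 3)
    + w (Edge {2,3}) * of_bool (p 2 = p 3)
    + (\<Sum>u=4..n. if u \<in> S then w (Rep u) else
        w (Edge {1,u}) * of_bool (p 1 = q u) + w (Edge {2,u}) * of_bool (p 2 = q u)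
        + w (Edge {3,u}) * of_bool (p 3 = q u))"
proof -
  let ?r = "glue p S q"
  let ?W = "\<lambda>e. w (Edge e) * char_entry (fibres n ?r) (Edge e)"
  have small: "?r i = p i" if "i \<in> {1,2,3}" for i using that by (auto simp: glue_def)
  have p: "p i \<le> 3" if "i \<in> {1,2,3}" for i
    using G that rep_mapD(4)[of 3 p i] by (auto simp: glueable_def)
  have q: "q u \<le> 3" for u using G unfolding glueable_def by (metis atLeastAtMost_iff atLeastAtMost_1_3)
  have small_edge: "?W {i,j} = w (Edge {i,j}) * of_bool (p i = p j)"
    if "i \<in> {1,2,3}" "j \<in> {1,2,3}" for i j
  proof -
    have "i \<in> {1..n}" "j \<in> {1..n}" using that assms(2) by auto
    then show ?thesis by (simp add: same_cluster_fibres small[OF that(1)] small[OF that(2)])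
  qed
  have edge: "?W {i,u} = (if u \<in> S then 0 else w (Edge {i,u}) * of_bool (p i = q u))"
    if "i \<in> {1,2,3}" "u \<in> {4..n}" for i u
  proof -
    have "i \<in> {1..n}" "u \<in> {1..n}" using that assms(2) by auto
    moreover have "?r u = (if u \<in> S then u else q u)" using that(2) by (simp add: glue_def)
    moreover have "p i \<noteq> u" using p[OF that(1)] that(2) by auto
    ultimately show ?thesis by (simp add: same_cluster_fibres small[OF that(1)])
  qed
  have vertex: "w (Rep u) * char_entry (fibres n ?r) (Rep u) = (if u \<in> S then w (Rep u) else 0)"
    if "u \<in> {4..n}" for u
  proof -
    have "u \<in> {1..n}" "q u \<noteq> u" using that q[of u] by auto
    moreover have "?r u = (if u \<in> S then u else q u)" using that by (simp add: glue_def)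
    ultimately show ?thesis by (simp add: representative_fibres[OF rep_map_glue[OF G]])
  qed
  have "(\<Sum>c\<in>coords n. w c * char_entry (fibres n ?r) c) = ?W {1,2} + ?W {1,3} + ?W {2,3}
      + (\<Sum>u=4..n. ?W {1,u} + ?W {2,u} + ?W {3,u} + w (Rep u) * char_entry (fibres n ?r) (Rep u))"
    unfolding sum_coords by (subst sum_edges_split[OF assms(2)]) (simp_all add: w sum.distrib)
  also have "(\<Sum>u=4..n. ?W {1,u} + ?W {2,u} + ?W {3,u}
        + w (Rep u) * char_entry (fibres n ?r) (Rep u)) =
      (\<Sum>u=4..n. if u \<in> S then w (Rep u) else
        w (Edge {1,u}) * of_bool (p 1 = q u) + w (Edge {2,u}) * of_bool (p 2 = q u)
        + w (Edge {3,u}) * of_bool (p 3 = q u))"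
  proof (rule sum.cong[OF refl])
    fix u assume u: "u \<in> {4..n}"
    have "1 \<in> {1,2,3::nat}" "2 \<in> {1,2,3::nat}" "3 \<in> {1,2,3::nat}" by auto
    note this[THEN edge, OF u]
    then show "?W {1,u} + ?W {2,u} + ?W {3,u} + w (Rep u) * char_entry (fibres n ?r) (Rep u) =
      (if u \<in> S then w (Rep u) else
        w (Edge {1,u}) * of_bool (p 1 = q u) + w (Edge {2,u}) * of_bool (p 2 = q u)
        + w (Edge {3,u}) * of_bool (p 3 = q u))"
      unfolding vertex[OF u] by (simp only: if_True if_False add_0_left add_0_right split: if_split) simp
  qed
  also have "?W {1,2} = w (Edge {1,2}) * of_bool (p 1 = p 2)" by (rule small_edge) auto
  also have "?W {1,3} = w (Edge {1,3}) * of_bool (p 1 = p 3)" by (rule small_edge) auto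
  also have "?W {2,3} = w (Edge {2,3}) * of_bool (p 2 = p 3)" by (rule small_edge) auto
  finally show ?thesis .
qed

section \<open>Functionals constant on the face\<close>

lemma sum_eq_imp_eq_at:
  fixes f g :: "'a \<Rightarrow> real"
  assumes "finite A" "u \<in> A" "\<And>x. x \<in> A - {u} \<Longrightarrow> f x = g x" "sum f A = sum g A"
  shows "f u = g u"
proof -
  have "sum f (A - {u}) = sum g (A - {u})" using assms(3) by (rule sum.cong[OF refl])
  then show ?thesis using assms(4) by (simp add: sum.remove[OF assms(1,2)])
qed

text \<open>The condition \<open>r 3 = 3 \<or> r 3 = r a\<close> selects the vertices of the face,
  and the conclusion says that \<open>w\<close> is \<open>s\<close> times the coefficient vector of
  the inequality.\<close>

lemma face_functional:
  fixes w :: "coord \<Rightarrow> real"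
  assumes K: "3 \<le> K" "K + 2 \<le> n" and a: "a \<in> {1, 2}"
    and const: "\<And>r. \<lbrakk>rep_map n r; card (r ` {1..n}) = K; r 3 = 3 \<or> r 3 = r a\<rbrakk>
      \<Longrightarrow> (\<Sum>c\<in>coords n. w c * char_entry (fibres n r) c) = d"
  obtains s where "\<And>i. i \<in> {4..n} \<Longrightarrow> w (Rep i) = - s"
    "\<And>e. e \<in> edges n \<Longrightarrow> w (Edge e) = s * (of_bool (e = {1,2}) + of_bool (e = {a,3}))"
proof -
  define L where "L r = (\<Sum>c\<in>coords n. w c * char_entry (fibres n r) c)" for r
  \<comment> \<open>With \<open>id\<close> and the constant map 1, these are the four clusterings of
    1, 2, 3 that the face admits.\<close>
  define p12 where "p12 = (\<lambda>x::nat. if x = 2 then 1 else x)"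
  define pa3 where "pa3 = (\<lambda>x::nat. if x = 3 then a else x)"
  have n: "5 \<le> n" "3 \<le> n" using K by auto
  \<comment> \<open>Room for \<open>m\<close> singletons that avoid \<open>U\<close>. The uses with
    \<open>m = K - 3\<close> and two excluded vertices, \<open>m = K - 2\<close> and one, and
    \<open>m = K - 1\<close> and none each need exactly \<open>K + 2 \<le> n\<close>.\<close>
  have subset: "\<exists>S. S \<subseteq> {4..n} - U \<and> card S = m"
    if "m + card U + 3 \<le> n" "U \<subseteq> {4..n}" for m U
  proof -
    have "card ({4..n} - U) = n - 3 - card U"
      using that(2) by (simp add: card_Diff_subset finite_subset)
    then show ?thesis using that(1) obtain_subset_with_card_n[of m "{4..n} - U"] by (metis add_le_imp_le_diff diff_diff_left add.commute add.left_commute)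
  qed
  have L: "L (glue p S q) = d"
    if "glueable n p S q" "card (p ` {1..3}) + card S = K" "p 3 = 3 \<or> p 3 = p a" for p S q
    unfolding L_def
    by (rule const) (use that a rep_map_glue card_glue n in \<open>auto simp: glue_def\<close>)
  have Lid: "L (glue id S q) = d"
    if "S \<subseteq> {4..n}" "card S = K - 3" "\<And>x. q x \<in> {1,2,3}" for S q
    by (rule L) (use that K in \<open>auto simp: glueable_def rep_map_def\<close>)
  have L12: "L (glue p12 S q) = d"
    if "S \<subseteq> {4..n}" "card S = K - 2" "\<And>x. q x \<in> {1,3}" for S q
  proof (rule L)
    have "p12 ` {1..3} = {1,3}" by (auto simp: p12_def atLeastAtMost_1_3)
    then show "card (p12 ` {1..3}) + card S = K" using that K by simp
    \<comment> \<open>Under \<open>p12\<close> vertex 2 is not a representative, so nothing may be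
      attached to it.\<close>
    have "q x \<noteq> 2" for x using that(3)[of x] by auto
    then show "glueable n p12 S q"
      using that by (auto simp: p12_def glueable_def rep_map_def)
  qed (simp add: p12_def)

  have w_uv: "w (Edge {u, v}) = 0" if uv: "u \<in> {4..n}" "v \<in> {4..n}" "u \<noteq> v" for u v
  proof -
    obtain S where S: "S \<subseteq> {4..n} - {u, v}" "card S = K - 3"
      using subset[of "K - 3" "{u, v}"] uv K by auto
    define q where "q i j = ((\<lambda>_. 1)(u := i, v := j))" for i j :: nat
    define g where "g = glue id S (q 1 1)"
    define E where "E i j = char_entry (fibres n (glue id S (q i j)))" for i j
    have rm: "rep_map n (glue id S (q i j))" if "i \<in> {1,2}" "j \<in> {1,2}" for i j
      by (rule rep_map_glue) (use that S in \<open>auto simp: glueable_def rep_map_def q_def\<close>)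
    have "L (glue id S (q i j)) = d" if "i \<in> {1,2}" "j \<in> {1,2}" for i j
      by (rule Lid) (use that S in \<open>auto simp: q_def\<close>)
    then have "(\<Sum>c\<in>coords n. w c * E i j c) = d" if "i \<in> {1,2}" "j \<in> {1,2}" for i j
      using that by (simp add: L_def E_def)
    \<comment> \<open>In this mixed second difference every coordinate depending on the place of at
      most one of \<open>u\<close>, \<open>v\<close> cancels. Only their common edge survives: it is
      1 when both go to the same cluster and 0 otherwise, which gives the factor 2.\<close>
    then have "0 = (\<Sum>c\<in>coords n. w c * E 1 1 c) + (\<Sum>c\<in>coords n. w c * E 2 2 c)
        - (\<Sum>c\<in>coords n. w c * E 1 2 c) - (\<Sum>c\<in>coords n. w c * E 2 1 c)" by simp
    also have "\<dots> = (\<Sum>c\<in>coords n. w c * (E 1 1 c + E 2 2 c - E 1 2 c - E 2 1 c))"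
      by (simp add: sum.distrib sum_subtractf algebra_simps)
    also have "\<dots> = (\<Sum>c\<in>coords n. if c = Edge {u, v} then 2 * w c else 0)"
    proof (rule sum.cong[OF refl])
      fix c assume c: "c \<in> coords n"
      show "w c * (E 1 1 c + E 2 2 c - E 1 2 c - E 2 1 c) = (if c = Edge {u, v} then 2 * w c else 0)"
      proof (cases c)
        case (Rep x)
        then have x: "x \<in> {4..n}" using c by (simp add: Rep_coords)
        have "E i j c = of_bool (x \<in> S)" if "i \<in> {1,2}" "j \<in> {1,2}" for i j
          using representative_fibres[OF rm[OF that], of x] x that
          by (auto simp: E_def Rep glue_def q_def)
        then show ?thesis using Rep by simp
      next
        case (Edge e)
        then obtain x y where xy: "e = {x, y}" "x \<in> {1..n}" "y \<in> {1..n}" "x \<noteq> y"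
          using c by (auto simp: coords_def edges_def)
        have "E i j c = of_bool (glue id S (q i j) x = glue id S (q i j) y)" for i j
          using same_cluster_fibres[OF xy(2,3)] by (simp add: E_def Edge xy(1))
        moreover have "glue id S (q i j) z = (if z = u then i else if z = v then j else g z)"
          for i j z using uv S by (auto simp: glue_def q_def g_def)
        ultimately show ?thesis
          using uv(3) xy(4) by (simp add: Edge xy(1) doubleton_eq_iff)
      qed
    qed
    also have "\<dots> = 2 * w (Edge {u, v})"
      using uv by (simp add: sum.delta' finite_coords Edge_coords)
    finally show ?thesis by simp
  qed

  define \<phi> where "\<phi> p S q u = (if u \<in> S then w (Rep u) else
      w (Edge {1,u}) * of_bool (p 1 = q u) + w (Edge {2,u}) * of_bool (p 2 = q u)
      + w (Edge {3,u}) * of_bool (p 3 = q u))"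
    for p :: "nat \<Rightarrow> nat" and S :: "nat set" and q :: "nat \<Rightarrow> nat" and u :: nat
  have L_glue: "L (glue p S q) = w (Edge {1,2}) * of_bool (p 1 = p 2)
      + w (Edge {1,3}) * of_bool (p 1 = p 3) + w (Edge {2,3}) * of_bool (p 2 = p 3)
      + (\<Sum>u=4..n. \<phi> p S q u)" if "glueable n p S q" for p S q
    unfolding L_def \<phi>_def using that n(2) w_uv by (rule sum_glue)
  \<comment> \<open>All attached vertices other than \<open>u\<close> stay with 1, so two such
    clusterings with the same \<open>S\<close> differ only in the summand of
    \<open>u\<close>.\<close>
  define move where "move i u = (\<lambda>_. 1)(u := i)" for i u :: nat

  have w_iu: "w (Edge {i, u}) = 0" if u: "u \<in> {4..n}" and i: "i \<in> {1,2,3}" for i u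
  proof -
    have w_eq: "w (Edge {i, u}) = w (Edge {1, u})" if i: "i \<in> {1,2,3}" for i
    proof -
      obtain S where S: "S \<subseteq> {4..n} - {u}" "card S = K - 3"
        using subset[of "K - 3" "{u}"] u K by auto
      have "(\<Sum>x=4..n. \<phi> id S (move j u) x) = d" if "j \<in> {1,2,3}" for j
      proof -
        have "glueable n id S (move j u)"
          using that S by (auto simp: glueable_def rep_map_def move_def)
        moreover have "L (glue id S (move j u)) = d"
          by (rule Lid) (use that S in \<open>auto simp: move_def\<close>)
        ultimately show ?thesis using L_glue[of id S "move j u"] by simp
      qed
      then have "(\<Sum>x=4..n. \<phi> id S (move i u) x) = (\<Sum>x=4..n. \<phi> id S (move 1 u) x)"
        using i by simp
      then have "\<phi> id S (move i u) u = \<phi> id S (move 1 u) u"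
        by (intro sum_eq_imp_eq_at[where f = "\<phi> id S (move i u)" and g = "\<phi> id S (move 1 u)", OF _ u])
          (simp_all add: \<phi>_def move_def)
      moreover have "u \<notin> S" using S by auto
      ultimately show ?thesis using i by (auto simp: \<phi>_def move_def)
    qed
    \<comment> \<open>With 1 and 2 joined, moving \<open>u\<close> from their cluster to that of 3
      yields w_1u + w_2u = w_3u; as the three are equal, they vanish.\<close>
    obtain S where S: "S \<subseteq> {4..n} - {u}" "card S = K - 2"
      using subset[of "K - 2" "{u}"] u K by auto
    have "w (Edge {1, 2}) + (\<Sum>x=4..n. \<phi> p12 S (move j u) x) = d" if "j \<in> {1,3}" for j
    proof -
      have "glueable n p12 S (move j u)"
        using that S by (auto simp: glueable_def rep_map_def move_def p12_def)
      moreover have "L (glue p12 S (move j u)) = d"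
        by (rule L12) (use that S in \<open>auto simp: move_def\<close>)
      ultimately show ?thesis using L_glue[of p12 S "move j u"] by (simp add: p12_def)
    qed
    from this[of 1] this[of 3]
    have "(\<Sum>x=4..n. \<phi> p12 S (move 1 u) x) = (\<Sum>x=4..n. \<phi> p12 S (move 3 u) x)" by simp
    then have "\<phi> p12 S (move 1 u) u = \<phi> p12 S (move 3 u) u"
      by (intro sum_eq_imp_eq_at[where f = "\<phi> p12 S (move 1 u)" and g = "\<phi> p12 S (move 3 u)", OF _ u])
        (simp_all add: \<phi>_def move_def)
    moreover have "u \<notin> S" using S by auto
    ultimately have "w (Edge {1, u}) + w (Edge {2, u}) = w (Edge {3, u})"
      by (simp add: \<phi>_def move_def p12_def)
    then have "w (Edge {1, u}) = 0" using w_eq[of 2] w_eq[of 3] by simp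
    then show ?thesis using w_eq[OF i] by simp
  qed
  \<comment> \<open>Attached vertices no longer contribute, so all of them may be attached to
    1.\<close>
  have L_glue': "w (Edge {1,2}) * of_bool (p 1 = p 2)
      + w (Edge {1,3}) * of_bool (p 1 = p 3) + w (Edge {2,3}) * of_bool (p 2 = p 3)
      + (\<Sum>u\<in>S. w (Rep u)) = d"
    if p: "rep_map 3 p" "p 3 = 3 \<or> p 3 = p a" and S: "S \<subseteq> {4..n}"
      and card: "card (p ` {1..3}) + card S = K" for p S
  proof -
    have "p 1 = 1" using rep_mapD(1,2)[OF p(1), of 1] by simp
    then have glueable: "glueable n p S (\<lambda>_. 1)" using p S by (simp add: glueable_def)
    have "(\<Sum>u=4..n. \<phi> p S (\<lambda>_. 1) u) = (\<Sum>u=4..n. if u \<in> S then w (Rep u) else 0)"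
      by (rule sum.cong) (auto simp: \<phi>_def w_iu)
    also have "\<dots> = (\<Sum>u\<in>S. w (Rep u))"
      using S by (simp add: sum.inter_restrict[symmetric] Int_absorb1)
    finally show ?thesis using L_glue[OF glueable] L[OF glueable card p(2)] by simp
  qed
  have p12: "rep_map 3 p12" "p12 ` {1..3} = {1,3}"
    by (auto simp: rep_map_def p12_def atLeastAtMost_1_3)
  have w_u: "w (Rep u) = w (Rep v)" if uv: "u \<in> {4..n}" "v \<in> {4..n}" "u \<noteq> v" for u v
  proof -
    obtain T where T: "T \<subseteq> {4..n} - {u, v}" "card T = K - 3"
      using subset[of "K - 3" "{u, v}"] uv K by auto
    then have fin: "finite T" using finite_subset by blast
    \<comment> \<open>With 1, 2, 3 separate there might be no singleton to exchange
      (\<open>K = 3\<close>); joining 1 and 2 leaves \<open>K - 2 \<ge> 1\<close> of them, namely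
      \<open>T\<close> and \<open>x\<close>.\<close>
    have "w (Edge {1,2}) + (w (Rep x) + (\<Sum>u\<in>T. w (Rep u))) = d" if "x \<in> {u, v}" for x
    proof -
      have "x \<notin> T" using T that by auto
      moreover have "insert x T \<subseteq> {4..n}" using T that uv by auto
      moreover have "card (insert x T) = K - 2" using T fin \<open>x \<notin> T\<close> K by simp
      ultimately show ?thesis using L_glue'[OF p12(1), of "insert x T"] p12(2) fin K
        by (simp add: p12_def)
    qed
    from this[of u] this[of v] show ?thesis by simp
  qed
  \<comment> \<open>The sign matches the coefficient -1 of the representative variables in the
    inequality.\<close>
  define s where "s = - w (Rep 4)"
  have s: "w (Rep u) = - s" if "u \<in> {4..n}" for u
    using w_u[of u 4] that n by (cases "u = 4") (auto simp: s_def)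
  have relation: "w (Edge {1,2}) * of_bool (p 1 = p 2)
      + w (Edge {1,3}) * of_bool (p 1 = p 3) + w (Edge {2,3}) * of_bool (p 2 = p 3)
      - s * (real K - real m) = d"
    if p: "rep_map 3 p" "p 3 = 3 \<or> p 3 = p a" and m: "card (p ` {1..3}) = m" "1 \<le> m" "m \<le> 3"
    for p m
  proof -
    obtain S where S: "S \<subseteq> {4..n}" "card S = K - m"
    proof -
      have "K - m + card {} + 3 \<le> n" using m(2) K by simp
      then show ?thesis using subset[of "K - m" "{}"] that by auto
    qed
    have "(\<Sum>u\<in>S. w (Rep u)) = (\<Sum>u\<in>S. - s)" using S by (intro sum.cong) (auto intro!: s)
    then show ?thesis using L_glue'[OF p S(1)] S(2) m K by (simp add: of_nat_diff algebra_simps)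
  qed
  \<comment> \<open>The first equation determines \<open>d\<close>. The next two then give
    \<open>s\<close> for the edges 12 and a3, and the last makes the sum of all three coefficients
    \<open>2 * s\<close>, so the remaining one is 0.\<close>
  have "- s * (real K - 3) = d"
    using relation[of id 3] by (simp add: rep_map_def)
  moreover have "w (Edge {1,2}) - s * (real K - 2) = d"
    using relation[OF p12(1), of 2] p12(2) by (simp add: p12_def)
  moreover have "w (Edge {a,3}) - s * (real K - 2) = d"
  proof -
    have "pa3 ` {1..3} = {1,2}" "rep_map 3 pa3"
      using a by (auto simp: rep_map_def pa3_def atLeastAtMost_1_3)
    then show ?thesis using relation[of pa3 2] a by (auto simp: pa3_def)
  qed
  moreover have "w (Edge {1,2}) + w (Edge {1,3}) + w (Edge {2,3}) - s * (real K - 1) = d"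
    using relation[of "\<lambda>_. 1" 1] by (simp add: rep_map_def image_constant_conv)
  ultimately have w3: "w (Edge {1,2}) = s" "w (Edge {a,3}) = s"
      "w (Edge {1,2}) + w (Edge {1,3}) + w (Edge {2,3}) = 2 * s"
    by (simp_all add: algebra_simps)
  show thesis
  proof (rule that[OF s])
    fix e assume "e \<in> edges n"
    then obtain i j where ij: "e = {i, j}" "i \<in> {1..n}" "j \<in> {1..n}" "i \<noteq> j"
      by (auto simp: edges_def)
    have small: "k \<in> {1,2,3} \<or> k \<in> {4..n}" if "k \<in> {1..n}" for k using that by auto
    show "w (Edge e) = s * (of_bool (e = {1,2}) + of_bool (e = {a,3}))"
    proof (cases "i \<in> {1,2,3} \<and> j \<in> {1,2,3}")
      case True
      then have "e = {1,2} \<or> e = {1,3} \<or> e = {2,3}"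
        using ij(1,4) by (elim conjE insertE emptyE) (simp_all add: doubleton_eq_iff)
      then show ?thesis using a w3 by (auto simp: doubleton_eq_iff)
    next
      case False
      then have "w (Edge e) = 0"
        using small[OF ij(2)] small[OF ij(3)] w_uv[of i j] w_iu[of i j] w_iu[of j i] ij(1,4)
        by (metis insert_commute)
      moreover have "e \<noteq> {1,2}" "e \<noteq> {a,3}" using False ij(1) a by (auto simp: doubleton_eq_iff)
      ultimately show ?thesis by simp
    qed
  qed
qed


section \<open>The inequality defines a facet\<close>

theorem theorem4p4:
  fixes n K a :: nat and idx :: "coord \<Rightarrow> 'i::finite"
  assumes idx: "bij_betw idx (coords n) UNIV"
    and full: "full_dimensional (partition_polytope n K idx)"
    and a: "a \<in> {1, 2}"
  shows "facet_defining (partition_polytope n K idx)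
           (\<lambda>x. x $ idx (Edge {1, 2}) + x $ idx (Edge {a, 3}) - (\<Sum>i=4..n. x $ idx (Rep i)))
           (3 - real K)"
proof -
  define l where "l x = x $ idx (Edge {1, 2}) + x $ idx (Edge {a, 3}) - (\<Sum>i=4..n. x $ idx (Rep i))"
    for x :: "real^'i"
  let ?P = "partition_polytope n K idx" and ?v = "\<lambda>r. char_vec n idx (fibres n r)"
  let ?F = "{x \<in> ?P. l x = 3 - real K}"
  have K: "3 \<le> K" "K + 2 \<le> n" using partition_number_bounds[OF idx full] .
  then have n: "3 \<le> n" "4 \<le> n" by auto
  have a': "a \<in> {1..n}" "3 \<in> {1..n}" "a \<noteq> 3" "1 \<in> {1..n}" "2 \<in> {1..n}" using a n by auto
  have inj: "idx c = idx c' \<longleftrightarrow> c = c'" if "c \<in> coords n" "c' \<in> coords n" for c c'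
    using idx that by (auto simp: bij_betw_def inj_on_def)
  have lin: "linear l"
    unfolding l_def by (simp add: linear_iff algebra_simps sum.distrib sum_distrib_left)
  \<comment> \<open>Inserting the count of representatives cancels x_12 and leaves x_a3 + x_3 up to
    the constant \<open>2 - real K\<close>.\<close>
  have l_v: "l (?v r) = of_bool (r 3 = r a) + of_bool (r 3 = 3) + 2 - real K"
    if "rep_map n r" "card (r ` {1..n}) = K" for r
  proof -
    have "(\<Sum>i=4..n. ?v r $ idx (Rep i)) = real K - 2 + of_bool (r 1 = r 2) - of_bool (r 3 = 3)"
      using sum_representatives[OF that(1) n(1)] that by (simp add: char_vec_Rep[OF idx])
    moreover have "?v r $ idx (Edge {1,2}) = of_bool (r 1 = r 2)"
      by (rule char_vec_Edge[OF idx]) (use a' in simp_all)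
    moreover have "?v r $ idx (Edge {a,3}) = of_bool (r a = r 3)"
      by (rule char_vec_Edge[OF idx]) (use a' in simp_all)
    ultimately show ?thesis by (simp add: l_def eq_commute[of "r a" "r 3"])
  qed
  have v_in: "?v r \<in> ?P" if "card (r ` {1..n}) = K" for r
    unfolding partition_polytope_def using that K_partition_fibres[of n K r] by (intro hull_inc) blast
  have valid: "l x \<le> 3 - real K" if "x \<in> ?P" for x
  proof (rule convex_hull_linear_le[OF lin _ that[unfolded partition_polytope_def]])
    fix y assume "y \<in> char_vec n idx ` {\<pi>. K_partition n K \<pi>}"
    then obtain \<pi> where \<pi>: "K_partition n K \<pi>" "y = char_vec n idx \<pi>" by blast
    then obtain r where r: "rep_map n r" "\<pi> = fibres n r"
      unfolding K_partition_def by (blast elim: partition_eq_fibres)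
    then have "card (r ` {1..n}) = K" using \<pi> by (simp add: K_partition_fibres)
    \<comment> \<open>A representative cannot share its cluster with the smaller vertex
      \<open>a\<close>, so x_a3 and x_3 are never both 1.\<close>
    moreover have "r 3 = 3 \<Longrightarrow> r 3 \<noteq> r a" using rep_map_3_iff[OF r(1) n(1)] a by auto
    ultimately show "l y \<le> 3 - real K" using l_v[OF r(1)] \<pi>(2) r(2) by auto
  qed
  have l_axis_Rep: "l (axis (idx (Rep u)) 1) = -1" if u: "u \<in> {4..n}" for u
  proof -
    have "(\<Sum>i=4..n. axis (idx (Rep u)) (1::real) $ idx (Rep i)) = (\<Sum>i=4..n. if i = u then 1 else 0)"
      using u by (intro sum.cong) (auto simp: axis_def inj Rep_coords)
    then show ?thesis
      using a' u by (simp add: l_def axis_def inj Rep_coords Edge_coords)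
  qed
  then have "l (axis (idx (Rep 4)) 1) \<noteq> 0" using n by simp
  then have le: "aff_dim ?F \<le> int DIM(real^'i) - 1"
    by (rule aff_dim_le_if_linear_const[OF lin, where b = "3 - real K"]) simp
  have ge: "int DIM(real^'i) - 1 \<le> aff_dim ?F"
  proof -
    define R where "R = {r. rep_map n r \<and> card (r ` {1..n}) = K \<and> (r 3 = 3 \<or> r 3 = r a)}"
    have R: "?v r \<in> ?F" if "r \<in> R" for r
      using that rep_map_3_iff[OF _ n(1), of r] l_v[of r] v_in[of r] a by (auto simp: R_def)
    \<comment> \<open>A base point of the face: 1, 2, 3 in separate clusters, \<open>K - 3\<close>
      singletons, and the rest attached to 1.\<close>
    obtain r0 where "r0 \<in> R"
    proof -
      have "K - 3 \<le> card {4..n}" using K by simp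
      then obtain S where S: "S \<subseteq> {4..n}" "card S = K - 3"
        by (rule obtain_subset_with_card_n)
      then have glueable: "glueable n id S (\<lambda>_. 1)" by (auto simp: glueable_def rep_map_def)
      then have "glue id S (\<lambda>_. 1) \<in> R"
        using rep_map_glue[OF glueable] card_glue[OF glueable n(1)] S(2) K
        by (simp add: R_def) (simp add: glue_def)
      then show ?thesis by (rule that)
    qed
    \<comment> \<open>The coefficient vector of \<open>l\<close>, which must span all functionals
      constant on the face.\<close>
    define h :: "real^'i" where "h = (\<chi> k. l (axis k 1))"
    show ?thesis
    proof (rule aff_dim_ge_if_annihilator_le_span[OF R[OF \<open>r0 \<in> R\<close>], where h = h])
      fix g assume g: "\<And>x. x \<in> ?F \<Longrightarrow> g \<bullet> x = g \<bullet> ?v r0"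
      have "(\<Sum>c\<in>coords n. g $ idx c * char_entry (fibres n r) c) = g \<bullet> ?v r0"
        if "rep_map n r" "card (r ` {1..n}) = K" "r 3 = 3 \<or> r 3 = r a" for r
        using g[OF R[of r]] that by (simp add: inner_char_vec[OF idx] R_def)
      from face_functional[OF K a, where w = "\<lambda>c. g $ idx c", OF this]
      obtain s where s: "\<And>i. i \<in> {4..n} \<Longrightarrow> g $ idx (Rep i) = - s"
        "\<And>e. e \<in> edges n \<Longrightarrow> g $ idx (Edge e) = s * (of_bool (e = {1,2}) + of_bool (e = {a,3}))"
        by blast
      have "g $ idx c = s * h $ idx c" if c: "c \<in> coords n" for c
      proof (cases c)
        case (Rep u)
        then have u: "u \<in> {4..n}" using c by (simp add: Rep_coords)
        then have "h $ idx c = -1" by (simp add: h_def Rep l_axis_Rep)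
        then show ?thesis using s(1)[OF u] by (simp add: Rep)
      next
        case (Edge e)
        then have e: "e \<in> edges n" using c by (auto simp: coords_def)
        have "(\<Sum>i=4..n. axis (idx (Edge e)) (1::real) $ idx (Rep i)) = 0"
          using c by (intro sum.neutral) (auto simp: axis_def inj Rep_coords Edge)
        then have "h $ idx c = of_bool (e = {1,2}) + of_bool (e = {a,3})"
          using a' c by (simp add: h_def Edge l_def axis_def inj Edge_coords eq_commute[of _ e])
        then show ?thesis using s(2)[OF e] by (simp add: Edge)
      qed
      then have "g $ k = (s *\<^sub>R h) $ k" for k
        using bij_betw_inv_into_right[OF idx, of k] bij_betw_apply[OF bij_betw_inv_into[OF idx], of k]
        by (metis UNIV_I vector_scaleR_component real_scaleR_def)
      then have "g = s *\<^sub>R h" by (simp add: vec_eq_iff)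
      then show "g \<in> span {h}" by (simp add: span_base span_scale)
    qed
  qed
  have "aff_dim ?F = aff_dim ?P - 1"
    using le ge full by (simp add: full_dimensional_def)
  then have "facet_defining ?P l (3 - real K)"
    unfolding facet_defining_def using lin valid by simp
  then show ?thesis unfolding l_def .
qed

end
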